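(* Let $(\Omega,\mathcal F,\mu)$ be a complete probability space, $(f_i)_{i\in\mathbb N}$ a sequence of nonnegative measurable functions on it, and $\mathcal F'$ a sub-$\sigma$-field of $\mathcal F$. Let $0<p_i<\infty$, $i\in\mathbb N$, and $\sum_{i=1}^\infty\frac1{p_i}=\frac1p$ with $0<p<\infty$. If $\prod_{i=1}^\infty\|f_i\|_{L^{p_i}}<\infty$, then, almost everywhere, $$E_{\mathcal F'}\Big(\prod_{i=1}^\infty f_i^p\Big)^{\frac1p}\le\prod_{i=1}^\infty E_{\mathcal F'}(f_i^{p_i})^{\frac1{p_i}}.$$
   Context: $E_{\mathcal F'}(\cdot)=E(\cdot\mid\mathcal F')$ is conditional expectation. For a sequence $(c_i)$ of finite nonnegative numbers, $\prod_{i=1}^\infty c_i$ denotes $\lim_{n\to\infty}\prod_{i=1}^n c_i$ when this limit exists in $[0,\infty)$ (the value $0$ is allowed); "$\prod_{i=1}^\infty c_i<\infty$" means that this finite limit exists (in particular every $\|f_i\|_{L^{p_i}}$ is finite). Infinite products of functions are taken pointwise; part of the assertion is that the infinite products of functions appearing converge almost everywhere. For $0<q<\infty$, $\|f\|_{L^q}=(\int_\Omega|f|^q\,d\mu)^{1/q}$. *)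

theory Defs
  imports "HOL-Probability.Conditional_Expectation"
begin

definition Lq_norm :: "'a measure \<Rightarrow> real \<Rightarrow> ('a \<Rightarrow> real) \<Rightarrow> real" where
  "Lq_norm M q f = (\<integral>x. \<bar>f x\<bar> powr q \<partial>M) powr (1 / q)"

(* The Bochner integral of a non-integrable function is 0, so Lq_norm agrees with the
   [0,\<infinity>]-valued (quasi-)norm only under this condition. *)
definition finite_Lq_norm :: "'a measure \<Rightarrow> real \<Rightarrow> ('a \<Rightarrow> real) \<Rightarrow> bool" where
  "finite_Lq_norm M q f \<longleftrightarrow> integrable M (\<lambda>x. \<bar>f x\<bar> powr q)"

(* An infinite product is here just the limit of its partial products, so the value 0 is
   allowed even if no factor vanishes; convergent_prod and prodinf exclude that case. *)
definition inf_prod_converges :: "(nat \<Rightarrow> real) \<Rightarrow> bool" where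
  "inf_prod_converges c \<longleftrightarrow> convergent (\<lambda>n. \<Prod>i<n. c i)"

definition inf_prod :: "(nat \<Rightarrow> real) \<Rightarrow> real" where
  "inf_prod c = lim (\<lambda>n. \<Prod>i<n. c i)"

end

theory Submission
  imports Defs
begin

text \<open>
  Put \<open>g i = f i powr ps i\<close> and \<open>w i = p / ps i\<close>. The weights \<open>w i\<close> are positive and sum to 1, and
  \<open>f i powr p = g i powr w i\<close>, so after raising to the power \<open>p\<close> the claim reads
  \<open>E (\<Prod>i. g i powr w i) \<le> (\<Prod>i. G i powr w i)\<close> with \<open>G i = E (g i)\<close>, where \<open>E\<close> is the
  conditional expectation.

  The engine is the weighted inequality between the geometric and the arithmetic mean for
  countably many numbers: if \<open>a i \<ge> 0\<close> and \<open>\<Sum>i. w i * a i\<close> is finite, then the partial products of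
  the \<open>a i powr w i\<close> converge, and their limit is at most that sum (\<open>prod_powr_le_suminf\<close>).
  Convergence is not a separate matter: each factor is at most \<open>exp (w i * (a i - 1))\<close>, so the partial
  products become decreasing once they are divided by products which converge.
  The relative form \<open>prod_powr_le_mult_suminf\<close> compares \<open>a i\<close> with reference numbers \<open>c i > 0\<close> whose
  weighted product converges, when \<open>\<Sum>i. w i * (a i / c i)\<close> is finite.

  With the constants \<open>c i = \<integral> g i\<close>, that sum has integral \<open>\<Sum>i. w i = 1\<close> and is therefore finite almost
  everywhere; this gives the convergence of the product and an integrable bound
  (\<open>AE_prod_powr_convergent\<close>). Since \<open>G i\<close> has the same integral as \<open>g i\<close>, the same lemma shows
  that the product on the right-hand side converges.

  With \<open>c i = G i\<close>, the sum has conditional expectation at most 1, and the factor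
  \<open>\<Prod>i. G i powr w i\<close> in front of it is measurable for the smaller sigma-algebra, so it can be pulled
  out of the conditional expectation. This is the inequality (\<open>cond_exp_prod_powr_le\<close>). Where some
  \<open>G j\<close> vanishes, so does \<open>g j\<close>, up to a null set, and both sides are 0.
\<close>

section \<open>Weighted geometric means of infinitely many numbers\<close>

lemma powr_le_exp_weighted:
  fixes a w :: real
  assumes "0 \<le> a" "0 \<le> w"
  shows "a powr w \<le> exp (w * (a - 1))"
proof (cases "a = 0")
  case False
  with assms have "a > 0" by simp
  then have "w * ln a \<le> w * (a - 1)"
    using ln_le_minus_one[of a] assms by (intro mult_left_mono) auto
  with \<open>a > 0\<close> show ?thesis by (simp add: powr_def)
qed simp

text \<open>
  Dividing the factor \<open>a i powr w i\<close> by \<open>exp (w i * (a i - 1))\<close> leaves a number in \<open>[0, 1]\<close>. The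
  corrected partial products decrease, and the corrections multiply up to \<open>exp\<close> of a
  convergent series.
\<close>

lemma prod_powr_converges:
  fixes a w :: "nat \<Rightarrow> real"
  assumes a: "\<And>i. 0 \<le> a i" and w: "\<And>i. 0 \<le> w i" "w sums W"
    and wa: "(\<lambda>i. w i * a i) sums A"
  obtains L where "(\<lambda>n. \<Prod>i<n. a i powr w i) \<longlonglongrightarrow> L" "0 \<le> L" "L \<le> exp (A - W)"
proof -
  define r where "r i = a i powr w i * exp (- (w i * (a i - 1)))" for i
  have r: "0 \<le> r i" "r i \<le> 1" for i
  proof -
    show "0 \<le> r i" by (simp add: r_def)
    have "r i \<le> exp (w i * (a i - 1)) * exp (- (w i * (a i - 1)))"
      unfolding r_def by (intro mult_right_mono powr_le_exp_weighted a w) simp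
    then show "r i \<le> 1" by (simp add: exp_add[symmetric])
  qed
  have "decseq (\<lambda>n. \<Prod>i<n. r i)"
    by (intro decseq_SucI) (use r in \<open>auto intro!: mult_left_le prod_nonneg\<close>)
  moreover have "\<forall>n. 0 \<le> (\<Prod>i<n. r i)"
    using r by (auto intro!: prod_nonneg)
  ultimately obtain L where L: "(\<lambda>n. \<Prod>i<n. r i) \<longlonglongrightarrow> L" "\<forall>n. L \<le> (\<Prod>i<n. r i)"
    by (rule decseq_convergent)
  have "L \<le> 1" using L(2)[rule_format, of 0] by simp
  have "0 \<le> L"
    by (rule LIMSEQ_le_const[OF L(1)]) (use r in \<open>auto intro!: prod_nonneg\<close>)
  have "(\<lambda>i. w i * a i - w i) sums (A - W)"
    by (intro sums_diff wa w)
  then have "(\<lambda>n. \<Sum>i<n. w i * (a i - 1)) \<longlonglongrightarrow> A - W"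
    by (simp add: sums_def algebra_simps)
  with L(1) have "(\<lambda>n. (\<Prod>i<n. r i) * exp (\<Sum>i<n. w i * (a i - 1))) \<longlonglongrightarrow> L * exp (A - W)"
    by (intro tendsto_intros)
  moreover have "(\<Prod>i<n. r i) * exp (\<Sum>i<n. w i * (a i - 1)) = (\<Prod>i<n. a i powr w i)" for n
    by (simp add: r_def exp_sum prod.distrib[symmetric] mult.assoc exp_add[symmetric])
  ultimately show thesis
    using \<open>0 \<le> L\<close> \<open>L \<le> 1\<close> by (intro that[of "L * exp (A - W)"]) auto
qed

lemma prod_powr_tendsto_0:
  fixes a w :: "nat \<Rightarrow> real"
  assumes "a j = 0"
  shows "(\<lambda>n. \<Prod>i<n. a i powr w i) \<longlonglongrightarrow> 0"
proof (rule tendsto_eventually)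
  show "\<forall>\<^sub>F n in sequentially. (\<Prod>i<n. a i powr w i) = 0"
    using eventually_gt_at_top[of j] by eventually_elim (use assms in \<open>auto intro!: prod_zero\<close>)
qed

text \<open>
  The bound \<open>exp (A - 1)\<close> provided by \<open>prod_powr_converges\<close> exceeds \<open>A\<close> unless \<open>A = 1\<close>. Both sides of
  the claim are homogeneous of degree 1 in \<open>a\<close>, because the weights sum to 1, so it is enough to
  treat the numbers \<open>a i / A\<close>, whose weighted sum is 1.
\<close>

lemma prod_powr_le_suminf:
  fixes a w :: "nat \<Rightarrow> real"
  assumes a: "\<And>i. 0 \<le> a i" and w: "\<And>i. 0 < w i" "w sums 1"
    and wa: "(\<lambda>i. w i * a i) sums A"
  obtains L where "(\<lambda>n. \<Prod>i<n. a i powr w i) \<longlonglongrightarrow> L" "0 \<le> L" "L \<le> A"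
proof (cases "A = 0")
  case True
  then have "w i * a i = 0" for i
    using wa a w(1) suminf_eq_zero_iff[of "\<lambda>i. w i * a i"]
    by (auto simp: sums_iff less_imp_le)
  then have "a 0 = 0"
    using w(1)[of 0] by (metis less_irrefl mult_eq_0_iff)
  from prod_powr_tendsto_0[of a, OF this] show thesis
    using that[of 0] True by simp
next
  case False
  have "0 \<le> A"
    using wa suminf_nonneg[of "\<lambda>i. w i * a i"] a w(1) by (auto simp: sums_iff less_imp_le)
  with False have A: "A > 0" by simp
  have "(\<lambda>i. w i * (a i / A)) sums (A / A)"
    using sums_divide[OF wa, of A] by simp
  then obtain L where L: "(\<lambda>n. \<Prod>i<n. (a i / A) powr w i) \<longlonglongrightarrow> L" "0 \<le> L" "L \<le> exp (A / A - 1)"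
    using prod_powr_converges[of "\<lambda>i. a i / A" w 1 "A / A"] a A w by (auto simp: less_imp_le)
  have "(\<lambda>n. A powr (\<Sum>i<n. w i)) \<longlonglongrightarrow> A powr 1"
    using w(2) A by (intro tendsto_intros) (auto simp: sums_def)
  with L(1) have "(\<lambda>n. (\<Prod>i<n. (a i / A) powr w i) * A powr (\<Sum>i<n. w i)) \<longlonglongrightarrow> L * A powr 1"
    by (rule tendsto_mult)
  moreover have "(\<Prod>i<n. (a i / A) powr w i) * A powr (\<Sum>i<n. w i) = (\<Prod>i<n. a i powr w i)" for n
    using A a by (simp add: powr_sum prod.distrib[symmetric] powr_mult[symmetric])
  ultimately show thesis
    using A L by (intro that[of "L * A"]) (auto simp: mult_le_cancel_right1)
qed

text \<open>
  The mean inequality for the ratios \<open>a i / c i\<close>. The sum is taken in the extended nonnegative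
  reals, which is the form in which integration theory supplies its finiteness.
\<close>

lemma prod_powr_le_mult_suminf:
  fixes a c w :: "nat \<Rightarrow> real"
  assumes a: "\<And>i. 0 \<le> a i" and w: "\<And>i. 0 < w i" "w sums 1"
    and c: "\<And>i. 0 < c i" "(\<lambda>n. \<Prod>i<n. c i powr w i) \<longlonglongrightarrow> C"
    and fin: "(\<Sum>i. ennreal (w i * (a i / c i))) \<noteq> \<infinity>"
  obtains L where "(\<lambda>n. \<Prod>i<n. a i powr w i) \<longlonglongrightarrow> L" "0 \<le> L"
    "ennreal L \<le> ennreal C * (\<Sum>i. ennreal (w i * (a i / c i)))"
proof -
  let ?b = "\<lambda>i. a i / c i"
  have b: "0 \<le> w i * ?b i" "0 \<le> ?b i" for i using a c(1) w(1) by (auto simp: less_imp_le)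
  have sm: "summable (\<lambda>i. w i * ?b i)"
    using summable_suminf_not_top[of "\<lambda>i. w i * ?b i"] fin b by simp
  then obtain L where L: "(\<lambda>n. \<Prod>i<n. ?b i powr w i) \<longlonglongrightarrow> L" "0 \<le> L" "L \<le> (\<Sum>i. w i * ?b i)"
    using prod_powr_le_suminf[of ?b w, OF b(2) w summable_sums] by auto
  have "0 \<le> C"
    by (rule LIMSEQ_le_const[OF c(2)]) (auto intro!: prod_nonneg)
  have "(\<lambda>n. (\<Prod>i<n. c i powr w i) * (\<Prod>i<n. ?b i powr w i)) \<longlonglongrightarrow> C * L"
    using c(2) L(1) by (rule tendsto_mult)
  moreover have "(\<Prod>i<n. c i powr w i) * (\<Prod>i<n. ?b i powr w i) = (\<Prod>i<n. a i powr w i)" for n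
    unfolding prod.distrib[symmetric] powr_mult[symmetric] using c(1) by (simp add: less_imp_neq[symmetric])
  moreover have "ennreal (C * L) \<le> ennreal C * (\<Sum>i. ennreal (w i * ?b i))"
    using L(3) \<open>0 \<le> C\<close> \<open>0 \<le> L\<close> b suminf_ennreal2[OF b(1) sm]
    by (simp add: ennreal_mult mult_left_mono ennreal_leI)
  ultimately show thesis using \<open>0 \<le> C\<close> \<open>0 \<le> L\<close> that[of "C * L"] by simp
qed

lemma lim_eq_if_tendsto: "X \<longlonglongrightarrow> (L :: real) \<Longrightarrow> convergent X \<and> lim X = L"
  by (auto simp: convergent_def limI)

section \<open>Weighted geometric means of integrable functions\<close>

text \<open>
  Only the integrals of the \<open>g i\<close> enter the hypothesis on products, so the lemma serves
  both a sequence of functions and the sequence of their conditional expectations.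
  If some \<open>g j\<close> has integral 0, it vanishes almost everywhere, and so does the product; otherwise the
  integrals are admissible reference constants.
\<close>

lemma AE_prod_powr_convergent:
  fixes g :: "nat \<Rightarrow> 'a \<Rightarrow> real" and w :: "nat \<Rightarrow> real"
  assumes int: "\<And>i. integrable M (g i)" and g: "\<And>i. AE x in M. 0 \<le> g i x"
    and w: "\<And>i. 0 < w i" "w sums 1"
    and conv: "convergent (\<lambda>n. \<Prod>i<n. (\<integral>x. g i x \<partial>M) powr w i)"
  shows "AE x in M. convergent (\<lambda>n. \<Prod>i<n. g i x powr w i)"
    and "integrable M (\<lambda>x. lim (\<lambda>n. \<Prod>i<n. g i x powr w i))"
proof -
  let ?N = "\<lambda>i. \<integral>x. g i x \<partial>M"
  let ?P = "\<lambda>x n. \<Prod>i<n. g i x powr w i"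
  have [measurable]: "g i \<in> borel_measurable M" for i using int by auto
  have g': "AE x in M. \<forall>i. 0 \<le> g i x" using g by (simp add: AE_all_countable)
  have "(AE x in M. convergent (?P x)) \<and> integrable M (\<lambda>x. lim (?P x))"
  proof (cases "\<exists>j. ?N j = 0")
    case True
    then obtain j where "?N j = 0" ..
    then have "AE x in M. g j x = 0"
      using integral_nonneg_eq_0_iff_AE[OF int g] by simp
    then have z: "AE x in M. convergent (?P x) \<and> lim (?P x) = 0"
    proof eventually_elim
      case (elim x)
      show ?case using prod_powr_tendsto_0[of "\<lambda>i. g i x" j w] elim by (intro lim_eq_if_tendsto)
    qed
    then have "integrable M (\<lambda>x. lim (?P x)) \<longleftrightarrow> integrable M (\<lambda>x. 0 :: real)"
      by (intro integrable_cong_AE) auto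
    with z show ?thesis by auto
  next
    case False
    have N: "0 < ?N i" for i
      using False integral_nonneg_AE[OF g] by (metis order_le_less)
    obtain C where C: "(\<lambda>n. \<Prod>i<n. ?N i powr w i) \<longlonglongrightarrow> C"
      using conv by (auto simp: convergent_def)
    define S where "S x = (\<Sum>i. ennreal (w i * (g i x / ?N i)))" for x
    have [measurable]: "S \<in> borel_measurable M" unfolding S_def by measurable
    have "(\<integral>\<^sup>+x. S x \<partial>M) = (\<Sum>i. \<integral>\<^sup>+x. ennreal (w i * (g i x / ?N i)) \<partial>M)"
      unfolding S_def by (rule nn_integral_suminf) measurable
    also have "\<dots> = (\<Sum>i. ennreal (w i))"
    proof (rule suminf_cong)
      fix i
      have "(\<integral>\<^sup>+x. ennreal (w i * (g i x / ?N i)) \<partial>M) = ennreal (\<integral>x. w i * (g i x / ?N i) \<partial>M)"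
      proof (rule nn_integral_eq_integral)
        show "integrable M (\<lambda>x. w i * (g i x / ?N i))" using int by simp
        show "AE x in M. 0 \<le> w i * (g i x / ?N i)"
          using g[of i] by eventually_elim (use N[of i] w(1)[of i] in \<open>simp add: less_imp_le\<close>)
      qed
      then show "(\<integral>\<^sup>+x. ennreal (w i * (g i x / ?N i)) \<partial>M) = ennreal (w i)"
        using N[of i] by simp
    qed
    also have "\<dots> = ennreal 1"
      using w by (intro suminf_ennreal_eq) (auto simp: less_imp_le)
    finally have S: "(\<integral>\<^sup>+x. S x \<partial>M) = 1" by simp
    then have "AE x in M. S x \<noteq> \<infinity>"
      by (intro nn_integral_PInf_AE) auto
    with g' have *: "AE x in M. convergent (?P x) \<and> ennreal (norm (lim (?P x))) \<le> ennreal C * S x"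
    proof eventually_elim
      case (elim x)
      obtain L where L: "?P x \<longlonglongrightarrow> L" "0 \<le> L" "ennreal L \<le> ennreal C * S x"
        using prod_powr_le_mult_suminf[of "\<lambda>i. g i x" w ?N C] elim w N C unfolding S_def by auto
      with lim_eq_if_tendsto[OF L(1)] show ?case by simp
    qed
    have "(\<integral>\<^sup>+x. ennreal (norm (lim (?P x))) \<partial>M) \<le> (\<integral>\<^sup>+x. ennreal C * S x \<partial>M)"
      using * by (intro nn_integral_mono_AE) auto
    also have "\<dots> = ennreal C" by (simp add: nn_integral_cmult S)
    finally have "integrable M (\<lambda>x. lim (?P x))"
      by (intro integrableI_bounded) (auto simp: less_top[symmetric] top_unique)
    with * show ?thesis by auto
  qed
  then show "AE x in M. convergent (?P x)" "integrable M (\<lambda>x. lim (?P x))" by auto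
qed

section \<open>Conditional expectation of nonnegative functions\<close>

context sigma_finite_subalgebra
begin

lemma nn_cond_exp_suminf:
  fixes u :: "nat \<Rightarrow> 'a \<Rightarrow> ennreal"
  assumes [measurable]: "\<And>i. u i \<in> borel_measurable M"
  shows "AE x in M. (\<Sum>i. nn_cond_exp M F (u i) x) = nn_cond_exp M F (\<lambda>x. \<Sum>i. u i x) x"
proof (rule nn_cond_exp_charact)
  fix A assume A [measurable]: "A \<in> sets F"
  have [measurable]: "A \<in> sets M" using A subalg by (auto simp: subalgebra_def)
  have "(\<integral>\<^sup>+x\<in>A. (\<Sum>i. u i x) \<partial>M) = (\<Sum>i. \<integral>\<^sup>+x. indicator A x * u i x \<partial>M)"
    by (subst nn_integral_suminf[symmetric]) (auto simp: mult.commute)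
  also have "\<dots> = (\<Sum>i. \<integral>\<^sup>+x. indicator A x * nn_cond_exp M F (u i) x \<partial>M)"
    by (intro suminf_cong nn_cond_exp_intg[symmetric]) auto
  also have "\<dots> = (\<integral>\<^sup>+x\<in>A. (\<Sum>i. nn_cond_exp M F (u i) x) \<partial>M)"
    by (subst nn_integral_suminf[symmetric]) (auto simp: mult.commute)
  finally show "(\<integral>\<^sup>+x\<in>A. (\<Sum>i. u i x) \<partial>M) = (\<integral>\<^sup>+x\<in>A. (\<Sum>i. nn_cond_exp M F (u i) x) \<partial>M)" .
qed auto

text \<open>
  The arguments below mix the two notions of conditional expectation: series and products with
  measurable factors are harmless for the extended nonnegative version, whereas the
  theorem is about the real one.
\<close>

lemma nn_cond_exp_ennreal:
  assumes int: "integrable M f" and f: "AE x in M. 0 \<le> f x"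
  shows "AE x in M. nn_cond_exp M F (\<lambda>x. ennreal (f x)) x = ennreal (real_cond_exp M F f x)"
proof -
  have [measurable]: "f \<in> borel_measurable M" using int by auto
  have "AE x in M. nn_cond_exp M F (\<lambda>x. ennreal (- f x)) x = nn_cond_exp M F (\<lambda>x. 0) x"
    using f by (intro nn_cond_exp_cong) (auto simp: ennreal_neg)
  moreover have "AE x in M. (0::ennreal) = nn_cond_exp M F (\<lambda>x. 0) x"
    by (rule nn_cond_exp_charact) auto
  moreover have "(\<integral>\<^sup>+x. nn_cond_exp M F (\<lambda>x. ennreal (f x)) x \<partial>M) = (\<integral>\<^sup>+x. ennreal (f x) \<partial>M)"
    using nn_cond_exp_intg[of "\<lambda>_. 1" "\<lambda>x. ennreal (f x)"] by simp
  then have "AE x in M. nn_cond_exp M F (\<lambda>x. ennreal (f x)) x \<noteq> \<infinity>"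
    using int f by (intro nn_integral_PInf_AE) (auto simp: nn_integral_eq_integral)
  ultimately show ?thesis
  proof eventually_elim
    case (elim x)
    then show ?case unfolding real_cond_exp_def by (simp add: less_top)
  qed
qed

text \<open>
  The zero set of the conditional expectation belongs to the smaller sigma-algebra, so \<open>f\<close> and its
  conditional expectation have the same integral over it, namely 0.
\<close>

lemma AE_eq_0_if_cond_exp_eq_0:
  assumes int: "integrable M f" and f: "AE x in M. 0 \<le> f x"
  shows "AE x in M. real_cond_exp M F f x = 0 \<longrightarrow> f x = 0"
proof -
  let ?G = "real_cond_exp M F f"
  have [measurable]: "f \<in> borel_measurable M" using int by auto
  define Z :: "'a \<Rightarrow> ennreal" where "Z x = (if ?G x = 0 then 1 else 0)" for x
  have Z [measurable]: "Z \<in> borel_measurable F" unfolding Z_def by measurable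
  have [measurable]: "Z \<in> borel_measurable M" unfolding Z_def by measurable
  have "(\<integral>\<^sup>+x. Z x * ennreal (f x) \<partial>M) = (\<integral>\<^sup>+x. Z x * nn_cond_exp M F (\<lambda>x. ennreal (f x)) x \<partial>M)"
    by (rule nn_cond_exp_intg[symmetric]) auto
  also have "\<dots> = (\<integral>\<^sup>+x. 0 \<partial>M)"
    using nn_cond_exp_ennreal[OF assms] by (intro nn_integral_cong_AE) (auto simp: Z_def)
  finally have "(\<integral>\<^sup>+x. Z x * ennreal (f x) \<partial>M) = 0"
    by simp
  then have "AE x in M. Z x * ennreal (f x) = 0"
    by (subst (asm) nn_integral_0_iff_AE) auto
  with f show ?thesis
    by eventually_elim (auto simp: Z_def split: if_splits)
qed

end

section \<open>The conditional Hoelder inequality for infinitely many functions\<close>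

text \<open>
  The function \<open>S\<close> of the proof is \<open>\<Sum>i. w i * (g i / G i)\<close>, where terms with \<open>G i = 0\<close> are replaced by 0,
  and \<open>C\<close> is the weighted product of the \<open>G i\<close>. The product of the \<open>g i\<close> is at most \<open>C * S\<close>, and \<open>S\<close>
  has conditional expectation at most 1.
  Nothing guarantees that \<open>C * S\<close> is integrable; this is why the conditional expectations
  are computed in the extended nonnegative reals.
\<close>

lemma (in finite_measure_subalgebra) cond_exp_prod_powr_le:
  fixes g :: "nat \<Rightarrow> 'a \<Rightarrow> real" and w :: "nat \<Rightarrow> real"
  assumes int: "\<And>i. integrable M (g i)" and g: "\<And>i. AE x in M. 0 \<le> g i x"
    and w: "\<And>i. 0 < w i" "w sums 1"
    and D: "integrable M (\<lambda>x. lim (\<lambda>n. \<Prod>i<n. g i x powr w i))"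
    and conv: "AE x in M. convergent (\<lambda>n. \<Prod>i<n. real_cond_exp M F (g i) x powr w i)"
  shows "AE x in M. real_cond_exp M F (\<lambda>x. lim (\<lambda>n. \<Prod>i<n. g i x powr w i)) x
    \<le> lim (\<lambda>n. \<Prod>i<n. real_cond_exp M F (g i) x powr w i)"
proof -
  let ?G = "\<lambda>i. real_cond_exp M F (g i)"
  let ?D = "\<lambda>x. lim (\<lambda>n. \<Prod>i<n. g i x powr w i)"
  define C where "C x = lim (\<lambda>n. \<Prod>i<n. ?G i x powr w i)" for x
  define H where "H i x = ennreal (if 0 < ?G i x then w i / ?G i x else 0)" for i x
  define S where "S x = (\<Sum>i. H i x * ennreal (g i x))" for x
  have [measurable]: "g i \<in> borel_measurable M" for i using int by auto
  have H [measurable]: "H i \<in> borel_measurable F" for i unfolding H_def by measurable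
  have HM [measurable]: "H i \<in> borel_measurable M" for i unfolding H_def by measurable
  have CF [measurable]: "C \<in> borel_measurable F" unfolding C_def by measurable
  have CM [measurable]: "C \<in> borel_measurable M" unfolding C_def by measurable
  have SM [measurable]: "S \<in> borel_measurable M" unfolding S_def by measurable
  have g': "AE x in M. \<forall>i. 0 \<le> g i x" using g by (simp add: AE_all_countable)
  have G': "AE x in M. \<forall>i. 0 \<le> ?G i x" using g by (simp add: AE_all_countable real_cond_exp_pos)
  have z: "AE x in M. \<forall>i. ?G i x = 0 \<longrightarrow> g i x = 0"
    using AE_eq_0_if_cond_exp_eq_0[OF int g] by (simp add: AE_all_countable)
  have e1: "AE x in M. \<forall>i. H i x * nn_cond_exp M F (\<lambda>x. ennreal (g i x)) x
      = nn_cond_exp M F (\<lambda>x. H i x * ennreal (g i x)) x"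
    using nn_cond_exp_prod[OF H] by (simp add: AE_all_countable)
  have e2: "AE x in M. \<forall>i. nn_cond_exp M F (\<lambda>x. ennreal (g i x)) x = ennreal (?G i x)"
    using nn_cond_exp_ennreal[OF int g] by (simp add: AE_all_countable)
  have e3: "AE x in M. (\<Sum>i. nn_cond_exp M F (\<lambda>x. H i x * ennreal (g i x)) x) = nn_cond_exp M F S x"
    unfolding S_def by (rule nn_cond_exp_suminf) auto
  have W: "(\<Sum>i. ennreal (w i)) = 1"
    using suminf_ennreal_eq[OF less_imp_le[OF w(1)] w(2)] by simp
  have S1: "AE x in M. nn_cond_exp M F S x \<le> 1"
    using e1 e2 e3
  proof eventually_elim
    case (elim x)
    have "nn_cond_exp M F S x = (\<Sum>i. H i x * ennreal (?G i x))"
      unfolding elim(3)[symmetric] using elim(1,2) by simp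
    also have "\<dots> \<le> (\<Sum>i. ennreal (w i))"
      using w(1) by (intro suminf_le) (auto simp: H_def ennreal_mult[symmetric] less_imp_le)
    finally show ?case by (simp add: W)
  qed
  \<comment> \<open>Finiteness of \<open>S\<close> has to be known before comparing with \<open>C * S\<close>: where \<open>C = 0\<close> and \<open>S = \<infinity>\<close>, the
     product \<open>C * S\<close> is 0 by convention, and the comparison could fail.\<close>
  have "(\<integral>\<^sup>+x. S x \<partial>M) = (\<integral>\<^sup>+x. nn_cond_exp M F S x \<partial>M)"
    using nn_cond_exp_intg[of "\<lambda>_. 1" S] by simp
  also have "\<dots> \<le> (\<integral>\<^sup>+x. 1 \<partial>M)"
    using S1 by (rule nn_integral_mono_AE)
  finally have "(\<integral>\<^sup>+x. S x \<partial>M) \<noteq> \<infinity>"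
    using emeasure_finite by (auto simp: top_unique)
  then have S2: "AE x in M. S x \<noteq> \<infinity>"
    by (intro nn_integral_PInf_AE) auto
  have le: "AE x in M. 0 \<le> ?D x \<and> ennreal (?D x) \<le> ennreal (C x) * S x"
    using g' G' z conv S2
  proof eventually_elim
    case (elim x)
    show ?case
    proof (cases "\<exists>j. ?G j x = 0")
      case True
      then obtain j where "g j x = 0" using elim by auto
      from lim_eq_if_tendsto[OF prod_powr_tendsto_0[of "\<lambda>i. g i x", OF this]] show ?thesis by simp
    next
      case False
      then have G: "0 < ?G i x" for i using elim by (metis order_le_less)
      have S: "S x = (\<Sum>i. ennreal (w i * (g i x / ?G i x)))"
        unfolding S_def H_def
        by (intro suminf_cong) (use G elim w(1) in \<open>auto simp: ennreal_mult[symmetric] less_imp_le\<close>)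
      have "(\<lambda>n. \<Prod>i<n. ?G i x powr w i) \<longlonglongrightarrow> C x"
        using elim by (simp add: C_def convergent_LIMSEQ_iff)
      then obtain L where "(\<lambda>n. \<Prod>i<n. g i x powr w i) \<longlonglongrightarrow> L" "0 \<le> L" "ennreal L \<le> ennreal (C x) * S x"
        using prod_powr_le_mult_suminf[of "\<lambda>i. g i x" w "\<lambda>i. ?G i x" "C x"] elim w G
        unfolding S by auto
      with lim_eq_if_tendsto[OF this(1)] show ?thesis by simp
    qed
  qed
  have f1: "AE x in M. nn_cond_exp M F (\<lambda>x. ennreal (?D x)) x = ennreal (real_cond_exp M F ?D x)"
    using le by (intro nn_cond_exp_ennreal[OF D]) auto
  have f2: "AE x in M. nn_cond_exp M F (\<lambda>x. ennreal (?D x)) x \<le> nn_cond_exp M F (\<lambda>x. ennreal (C x) * S x) x"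
    using le by (intro nn_cond_exp_mono) auto
  have f3: "AE x in M. ennreal (C x) * nn_cond_exp M F S x = nn_cond_exp M F (\<lambda>x. ennreal (C x) * S x) x"
    by (rule nn_cond_exp_prod) auto
  have "AE x in M. real_cond_exp M F ?D x \<le> C x"
    using f1 f2 f3 S1 conv
  proof eventually_elim
    case (elim x)
    have "ennreal (real_cond_exp M F ?D x) \<le> ennreal (C x) * 1"
      unfolding elim(1)[symmetric]
      by (rule order_trans[OF elim(2)]) (simp only: elim(3)[symmetric] mult_left_mono elim(4) zero_le)
    moreover have "0 \<le> C x"
      by (rule LIMSEQ_le_const[of "\<lambda>n. \<Prod>i<n. ?G i x powr w i"])
        (use elim in \<open>auto simp: C_def convergent_LIMSEQ_iff intro!: prod_nonneg\<close>)
    ultimately show ?case by simp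
  qed
  then show ?thesis by (simp add: C_def)
qed

lemma prod_powr_tendsto:
  fixes c :: "nat \<Rightarrow> real"
  assumes "\<And>i. 0 \<le> c i" "(\<lambda>n. \<Prod>i<n. c i) \<longlonglongrightarrow> C" "0 < r"
  shows "(\<lambda>n. \<Prod>i<n. c i powr r) \<longlonglongrightarrow> C powr r"
proof -
  have "\<forall>\<^sub>F n in sequentially. 0 \<le> (\<Prod>i<n. c i)"
    using assms(1) by (intro always_eventually allI prod_nonneg) auto
  then show ?thesis
    unfolding prod_powr_distrib[symmetric]
    using assms by (intro tendsto_powr' tendsto_const) auto
qed

theorem theorem2p16:
  fixes M F :: "'a measure"
    and f :: "nat \<Rightarrow> 'a \<Rightarrow> real"
    and ps :: "nat \<Rightarrow> real"
    and p :: real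
  assumes "prob_space M"
    and "complete_measure M"
    and "subalgebra M F"
    and "\<And>i. f i \<in> borel_measurable M"
    and "\<And>i x. x \<in> space M \<Longrightarrow> 0 \<le> f i x"
    and "\<And>i. 0 < ps i"
    and "0 < p"
    and "(\<lambda>i. 1 / ps i) sums (1 / p)"
    and "\<And>i. finite_Lq_norm M (ps i) (f i)"
    and "inf_prod_converges (\<lambda>i. Lq_norm M (ps i) (f i))"
  shows "(AE x in M. inf_prod_converges (\<lambda>i. f i x powr p))
    \<and> integrable M (\<lambda>x. inf_prod (\<lambda>i. f i x powr p))
    \<and> (AE x in M. inf_prod_converges
          (\<lambda>i. real_cond_exp M F (\<lambda>y. f i y powr ps i) x powr (1 / ps i)))
    \<and> (AE x in M. real_cond_exp M F (\<lambda>y. inf_prod (\<lambda>i. f i y powr p)) x powr (1 / p)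
          \<le> inf_prod (\<lambda>i. real_cond_exp M F (\<lambda>y. f i y powr ps i) x powr (1 / ps i)))"
proof -
  interpret prob_space M by fact
  interpret finite_measure_subalgebra M F
    by unfold_locales fact
  define g where "g i = (\<lambda>x. f i x powr ps i)" for i
  define w where "w i = p / ps i" for i
  let ?G = "\<lambda>i. real_cond_exp M F (g i)"
  have w: "0 < w i" for i using assms(6,7) by (simp add: w_def)
  have "(\<lambda>i. p * (1 / ps i)) sums (p * (1 / p))"
    by (intro sums_mult assms)
  then have w1: "w sums 1" using assms(7) by (simp add: w_def[abs_def])
  have abs: "integrable M (\<lambda>x. \<bar>f i x\<bar> powr ps i) \<longleftrightarrow> integrable M (g i)"
      "(\<integral>x. \<bar>f i x\<bar> powr ps i \<partial>M) = (\<integral>x. g i x \<partial>M)" for i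
    using assms(5) by (auto simp: g_def intro!: Bochner_Integration.integrable_cong Bochner_Integration.integral_cong)
  have int: "integrable M (g i)" for i
    using assms(9)[of i] abs by (simp add: finite_Lq_norm_def)
  have g: "AE x in M. 0 \<le> g i x" for i by (simp add: g_def)
  have fp: "f i x powr p = g i x powr w i" for i x
    using assms(6)[of i] by (simp add: g_def w_def powr_powr)
  have expo: "(y powr (1 / ps i)) powr p = y powr w i" "(y powr w i) powr (1 / p) = y powr (1 / ps i)" for i and y :: real
    using assms(7) by (auto simp: w_def powr_powr)
  obtain B where "(\<lambda>n. \<Prod>i<n. (\<integral>x. g i x \<partial>M) powr (1 / ps i)) \<longlonglongrightarrow> B"
    using assms(10) abs(2) by (auto simp: inf_prod_converges_def Lq_norm_def convergent_def)
  from prod_powr_tendsto[OF _ this assms(7)]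
  have conv: "convergent (\<lambda>n. \<Prod>i<n. (\<integral>x. g i x \<partial>M) powr w i)"
    by (auto simp: expo convergent_def)
  note gP = AE_prod_powr_convergent[OF int g w w1 conv]
  have intG: "integrable M (?G i)" and eqG: "(\<integral>x. ?G i x \<partial>M) = (\<integral>x. g i x \<partial>M)" for i
    using real_cond_exp_int[OF int] by auto
  have G: "AE x in M. 0 \<le> ?G i x" for i
    using g int by (intro real_cond_exp_pos) auto
  have GP: "AE x in M. convergent (\<lambda>n. \<Prod>i<n. ?G i x powr w i)"
    by (rule AE_prod_powr_convergent(1)[OF intG G w w1]) (use conv in \<open>simp add: eqG\<close>)
  have D0: "AE x in M. 0 \<le> lim (\<lambda>n. \<Prod>i<n. g i x powr w i)"
    using gP(1)
  proof eventually_elim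
    case (elim x)
    then show ?case
      by (intro LIMSEQ_le_const[of "\<lambda>n. \<Prod>i<n. g i x powr w i"])
        (auto simp: convergent_LIMSEQ_iff intro!: prod_nonneg)
  qed
  have ED0: "AE x in M. 0 \<le> real_cond_exp M F (\<lambda>x. lim (\<lambda>n. \<Prod>i<n. g i x powr w i)) x"
    using D0 gP(2) by (intro real_cond_exp_pos) auto
  have lims: "AE x in M. convergent (\<lambda>n. \<Prod>i<n. ?G i x powr (1 / ps i)) \<and>
      lim (\<lambda>n. \<Prod>i<n. ?G i x powr (1 / ps i)) = lim (\<lambda>n. \<Prod>i<n. ?G i x powr w i) powr (1 / p)"
    using GP
  proof eventually_elim
    case (elim x)
    then have "(\<lambda>n. \<Prod>i<n. ?G i x powr w i) \<longlonglongrightarrow> lim (\<lambda>n. \<Prod>i<n. ?G i x powr w i)"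
      by (simp add: convergent_LIMSEQ_iff)
    from prod_powr_tendsto[OF _ this, of "1 / p"] assms(7) show ?case
      by (intro lim_eq_if_tendsto) (simp add: expo)
  qed
  have ineq: "AE x in M. real_cond_exp M F (\<lambda>x. lim (\<lambda>n. \<Prod>i<n. g i x powr w i)) x powr (1 / p)
      \<le> lim (\<lambda>n. \<Prod>i<n. ?G i x powr (1 / ps i))"
    using cond_exp_prod_powr_le[OF int g w w1 gP(2) GP] ED0 lims
    by eventually_elim (use assms(7) in \<open>auto intro!: powr_mono2\<close>)
  show ?thesis
    unfolding inf_prod_def inf_prod_converges_def fp g_def[symmetric]
    using gP lims ineq by auto
qed

end
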